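(* Let $F$ be a field. Let $k,\ell$ be integers with $k>0$ and $0\le \ell\le k$. Let $m_1,\dots,m_k$ be positive integers such that exactly $\ell$ of them are odd and $k-\ell$ of them are even, and put $N_{k,\ell}=\sum_{i=1}^k m_i-2k+\ell+2$. Then there exists a unital associative $F$-algebra $A$ such that \[ T^{(m_1)}(A)\,T^{(m_2)}(A)\cdots T^{(m_k)}(A)\not\subseteq T^{(1+N_{k,\ell})}(A). \]
   Context: For an associative algebra $A$, left-normed commutators are defined by $[a_1,a_2]=a_1a_2-a_2a_1$ and $[a_1,\dots,a_{n-1},a_n]=[[a_1,\dots,a_{n-1}],a_n]$ for $n\ge 3$. For $n\ge 2$, $T^{(n)}(A)$ denotes the two-sided ideal of $A$ generated by all commutators $[a_1,\dots,a_n]$ with $a_i\in A$, and $T^{(1)}(A)=A$. Products of ideals are the usual products of two-sided ideals. *)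

theory Defs
  imports "HOL-Algebra.Ideal"
begin

definition unital_algebra ::
  "('a, 'b) ring_scheme \<Rightarrow> ('f::field \<Rightarrow> 'a \<Rightarrow> 'a) \<Rightarrow> bool" where
  "unital_algebra A smul \<longleftrightarrow>
     ring A \<and>
     (\<forall>c x. x \<in> carrier A \<longrightarrow> smul c x \<in> carrier A) \<and>
     (\<forall>c d x. x \<in> carrier A \<longrightarrow> smul (c + d) x = smul c x \<oplus>\<^bsub>A\<^esub> smul d x) \<and>
     (\<forall>c x y. x \<in> carrier A \<longrightarrow> y \<in> carrier A \<longrightarrow>
         smul c (x \<oplus>\<^bsub>A\<^esub> y) = smul c x \<oplus>\<^bsub>A\<^esub> smul c y) \<and>
     (\<forall>c d x. x \<in> carrier A \<longrightarrow> smul (c * d) x = smul c (smul d x)) \<and>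
     (\<forall>x. x \<in> carrier A \<longrightarrow> smul 1 x = x) \<and>
     (\<forall>c x y. x \<in> carrier A \<longrightarrow> y \<in> carrier A \<longrightarrow>
         smul c (x \<otimes>\<^bsub>A\<^esub> y) = smul c x \<otimes>\<^bsub>A\<^esub> y \<and>
         smul c (x \<otimes>\<^bsub>A\<^esub> y) = x \<otimes>\<^bsub>A\<^esub> smul c y)"

definition commutator :: "('a, 'b) ring_scheme \<Rightarrow> 'a \<Rightarrow> 'a \<Rightarrow> 'a" where
  "commutator A a b = a \<otimes>\<^bsub>A\<^esub> b \<ominus>\<^bsub>A\<^esub> b \<otimes>\<^bsub>A\<^esub> a"

fun lcomm_rev :: "('a, 'b) ring_scheme \<Rightarrow> 'a list \<Rightarrow> 'a" where
  "lcomm_rev A [] = \<zero>\<^bsub>A\<^esub>"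
| "lcomm_rev A [a] = a"
| "lcomm_rev A (a # as) = commutator A (lcomm_rev A as) a"

definition lcomm :: "('a, 'b) ring_scheme \<Rightarrow> 'a list \<Rightarrow> 'a" where
  "lcomm A as = lcomm_rev A (rev as)"

definition T_ideal :: "('a, 'b) ring_scheme \<Rightarrow> nat \<Rightarrow> 'a set" where
  "T_ideal A n =
     (if n \<le> 1 then carrier A
      else genideal A {lcomm A as | as. length as = n \<and> set as \<subseteq> carrier A})"

text \<open>Product of two-sided ideals I J: the additive subgroup spanned by all
  products xy (x in I, y in J), which is the ideal generated by these products.
  Product of a list of ideals I1 I2 ... Ik, bracketed as I1 (I2 (... Ik)).\<close>
definition ideal_mult :: "('a, 'b) ring_scheme \<Rightarrow> 'a set \<Rightarrow> 'a set \<Rightarrow> 'a set" where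
  "ideal_mult A I J = genideal A {x \<otimes>\<^bsub>A\<^esub> y | x y. x \<in> I \<and> y \<in> J}"

fun ideal_list_prod :: "('a, 'b) ring_scheme \<Rightarrow> 'a set list \<Rightarrow> 'a set" where
  "ideal_list_prod A [] = carrier A"
| "ideal_list_prod A [I] = I"
| "ideal_list_prod A (I # Is) = ideal_mult A I (ideal_list_prod A Is)"

end

theory Submission
  imports Defs "HOL-Library.Function_Algebras" "HOL-Library.Nat_Bijection"
begin

text \<open>
  Put \<open>p\<^sub>i = (m\<^sub>i - 1) div 2\<close> and \<open>n = p\<^sub>1 + \<dots> + p\<^sub>k\<close>. Then \<open>1 + N = 2n + 3\<close>, and a commutator
  of length \<open>2p\<^sub>i + 2 \<ge> m\<^sub>i\<close> lies in \<open>T\<^sup>(\<^sup>m\<^sup>i\<^sup>)\<close>, so it suffices to treat these lengths.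

  In characteristic other than 2 one could take the tensor product of two Grassmann algebras, the
  second one on \<open>2n\<close> generators. A variant that works over every field has generators \<open>x\<^sub>i\<close> over the
  even part of an exterior algebra on vectors \<open>\<epsilon>\<^sub>i\<close>, \<open>\<eta>\<^sub>i\<close>, only \<open>2n\<close> of the \<open>\<eta>\<^sub>i\<close> being nonzero, with
  \<open>x\<^sub>i x\<^sub>j = (1 + \<epsilon>\<^sub>i \<epsilon>\<^sub>j) (1 + \<eta>\<^sub>i \<eta>\<^sub>j) x\<^sub>j x\<^sub>i\<close>. Extending \<open>\<epsilon>\<close> and \<open>\<eta>\<close> additively to words, the same relation
  holds for words \<open>u\<close>, \<open>v\<close>, since \<open>1 + \<epsilon>\<^sub>u \<epsilon>\<^sub>v\<close> is bimultiplicative. In a left-normed commutator of words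
  each bracketing therefore contributes a factor \<open>a + b + a b\<close>, where \<open>a = \<epsilon>\<^sub>u \<epsilon>\<^sub>v\<close> and \<open>b = \<eta>\<^sub>u \<eta>\<^sub>v\<close> for \<open>u\<close>
  the part already bracketed and \<open>v\<close> the new word. Consecutive \<open>a\<close>'s, and consecutive \<open>b\<close>'s, share a
  vector and annihilate each other, so only the alternating products \<open>abab\<dots>\<close> and \<open>baba\<dots>\<close> survive. At
  length \<open>2n + 3\<close> these contain \<open>n + 1\<close> factors \<open>b\<close>, that is, \<open>2n + 2\<close> vectors from a space of
  dimension \<open>2n\<close>, and vanish. On the other hand, commutators of distinct generators of lengths
  \<open>2p\<^sub>i + 2\<close> use only \<open>2n\<close> of the \<open>\<eta>\<close>'s altogether, and their product is nonzero.

  The algebra \<open>A\<close> itself is the algebra of noncommutative power series, which maps to this one.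
\<close>

section \<open>Additive endomorphisms\<close>

text \<open>Algebra elements are modelled as operators, so associativity is automatic and relations
  are checked by evaluation.\<close>

typedef (overloaded) 'a endo = "{f :: 'a::ab_group_add \<Rightarrow> 'a. \<forall>x y. f (x + y) = f x + f y}"
  morphisms app Endo
  by (rule exI[of _ "\<lambda>x. x"]) simp

lemma app_add [simp]: "app f (x + y) = app f x + app f y"
  using app[of f] by simp

lemma app_zero [simp]: "app f 0 = 0"
  using app_add[of f 0 0] by simp

lemma endo_eqI: "(\<And>x. app f x = app g x) \<Longrightarrow> f = g"
  using app_inject by blast

instantiation endo :: (ab_group_add) "{ring, monoid_mult}"
begin

definition "0 = Endo (\<lambda>x. 0)"
definition "1 = Endo (\<lambda>x. x)"
definition "f + g = Endo (\<lambda>x. app f x + app g x)"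
definition "f - g = Endo (\<lambda>x. app f x - app g x)"
definition "- f = Endo (\<lambda>x. - app f x)"
definition "f * g = Endo (\<lambda>x. app f (app g x))"

lemma app_endo_ops:
  "app (0::'a endo) x = 0" "app (1::'a endo) x = x" "app (f + g) x = app f x + app g x"
  "app (f - g) x = app f x - app g x" "app (- f) x = - app f x"
  "app (f * g) x = app f (app g x)"
  by (simp_all add: zero_endo_def one_endo_def plus_endo_def minus_endo_def uminus_endo_def
      times_endo_def Endo_inverse algebra_simps)

instance
  by standard (rule endo_eqI; simp add: app_endo_ops algebra_simps)+

end

declare app_endo_ops [simp]

lemma commute_mult:
  fixes x :: "'a::semigroup_mult"
  assumes "x * a = a * x" "x * b = b * x"
  shows "x * (a * b) = a * b * x"
proof -
  have "x * (a * b) = a * (x * b)" using assms(1) by (simp flip: mult.assoc)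
  then show ?thesis using assms(2) by (simp add: mult.assoc)
qed

lemma mult_interchange:
  fixes a :: "'a::semigroup_mult"
  assumes "b * c = c * b"
  shows "(a * b) * (c * d) = (a * c) * (b * d)"
proof -
  have "(a * b) * (c * d) = a * (b * c) * d" by (simp add: mult.assoc)
  also have "\<dots> = (a * c) * (b * d)" unfolding assms by (simp add: mult.assoc)
  finally show ?thesis .
qed

section \<open>Exterior multiplication operators\<close>

text \<open>Read \<open>f J\<close> as the coefficient of the increasing wedge of the basis vectors
  with indices in \<open>J\<close>. Then \<open>cr i\<close> is left multiplication by the
  \<open>i\<close>-th basis vector, and the sign counts the smaller vectors it passes.\<close>

definition cr :: "nat \<Rightarrow> (nat set \<Rightarrow> 'f::field) endo" where
  "cr i = Endo (\<lambda>f J. if i \<in> J then (-1) ^ card {j \<in> J. j < i} * f (J - {i}) else 0)"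

definition sc :: "'f::field \<Rightarrow> (nat set \<Rightarrow> 'f) endo" where
  "sc c = Endo (\<lambda>f J. c * f J)"

lemma app_cr: "app (cr i) f J = (if i \<in> J then (-1) ^ card {j \<in> J. j < i} * f (J - {i}) else 0)"
  unfolding cr_def by (subst Endo_inverse) (auto simp: fun_eq_iff algebra_simps)

lemma app_sc: "app (sc c) f J = c * f J"
  unfolding sc_def by (subst Endo_inverse) (auto simp: fun_eq_iff algebra_simps)

lemma sc_hom: "sc (c + d) = sc c + sc d" "sc (c * d) = sc c * sc d" "sc 0 = 0" "sc 1 = 1"
  by (rule endo_eqI; simp add: fun_eq_iff app_sc algebra_simps)+

lemma sc_cr: "sc c * cr i = cr i * sc c"
  by (rule endo_eqI) (simp add: fun_eq_iff app_sc app_cr)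

lemma cr_square: "cr i * cr i = 0"
  by (rule endo_eqI) (simp add: fun_eq_iff app_cr)

text \<open>For \<open>i < j\<close>, the index \<open>i\<close> is counted in the sign of
  \<open>cr j\<close>, while \<open>j\<close> is not counted in that of \<open>cr i\<close>; the two
  orders differ by exactly this sign.\<close>

lemma cr_anticommute: "cr i * cr j = - (cr j * cr i :: (nat set \<Rightarrow> 'f::field) endo)"
proof -
  have less: "cr i * cr j = - (cr j * cr i :: (nat set \<Rightarrow> 'f) endo)" if "i < j" for i j
  proof (rule endo_eqI, rule ext)
    fix f :: "nat set \<Rightarrow> 'f" and J
    show "app (cr i * cr j) f J = app (- (cr j * cr i)) f J"
    proof (cases "i \<in> J \<and> j \<in> J")
      case True
      have "{x \<in> J. x < j} = insert i {x \<in> J - {i}. x < j}" using True that by auto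
      then have "card {x \<in> J. x < j} = Suc (card {x \<in> J - {i}. x < j})"
        by (simp add: card_insert_if)
      moreover have "{x \<in> J - {j}. x < i} = {x \<in> J. x < i}" using that by auto
      moreover have "J - {i} - {j} = J - {j} - {i}" by auto
      ultimately show ?thesis using True that by (simp add: app_cr)
    next
      case False
      then show ?thesis by (auto simp: app_cr)
    qed
  qed
  show ?thesis
    using less[of i j] less[of j i] by (cases i j rule: linorder_cases) (auto simp: cr_square)
qed

section \<open>Even and odd operators, and vectors\<close>

definition even_op :: "(nat set \<Rightarrow> 'f::field) endo \<Rightarrow> bool" where
  "even_op x \<longleftrightarrow> (\<forall>n. x * cr n = cr n * x) \<and> (\<forall>c. x * sc c = sc c * x)"

definition odd_op :: "(nat set \<Rightarrow> 'f::field) endo \<Rightarrow> bool" where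
  "odd_op x \<longleftrightarrow> (\<forall>n. x * cr n = - (cr n * x)) \<and> (\<forall>c. x * sc c = sc c * x)"

lemma even_op_one: "even_op 1"
  by (simp add: even_op_def)

lemma even_op_sc: "even_op (sc c)"
  by (simp add: even_op_def sc_cr flip: sc_hom) (simp add: mult.commute)

lemma even_op_add: "even_op x \<Longrightarrow> even_op y \<Longrightarrow> even_op (x + y)"
  by (simp add: even_op_def algebra_simps)

lemma even_op_mult: "even_op x \<Longrightarrow> even_op y \<Longrightarrow> even_op (x * y)"
  unfolding even_op_def by (metis commute_mult)

lemma odd_op_zero: "odd_op 0"
  by (simp add: odd_op_def)

lemma odd_op_cr: "odd_op (cr i)"
  using cr_anticommute by (auto simp: odd_op_def sc_cr)

lemma odd_op_add: "odd_op x \<Longrightarrow> odd_op y \<Longrightarrow> odd_op (x + y)"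
  by (simp add: odd_op_def algebra_simps)

lemma even_op_odd_mult: "odd_op x \<Longrightarrow> odd_op y \<Longrightarrow> even_op (x * y)"
proof -
  assume x: "odd_op x" and y: "odd_op y"
  have "x * y * cr n = cr n * (x * y)" for n
  proof -
    have "x * y * cr n = - (x * cr n * y)"
      using y by (simp add: odd_op_def mult.assoc)
    also have "\<dots> = cr n * (x * y)"
      using x by (simp add: odd_op_def mult.assoc)
    finally show ?thesis .
  qed
  moreover have "x * y * sc c = sc c * (x * y)" for c
  proof -
    have "x * y * sc c = x * sc c * y"
      using y by (simp add: odd_op_def mult.assoc)
    also have "\<dots> = sc c * (x * y)"
      using x by (simp add: odd_op_def mult.assoc)
    finally show ?thesis .
  qed
  ultimately show ?thesis by (simp add: even_op_def)
qed

inductive vec :: "(nat set \<Rightarrow> 'f::field) endo \<Rightarrow> bool" where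
  zero: "vec 0"
| cr_add: "vec x \<Longrightarrow> vec (cr n + x)"

lemma vec_cr: "vec (cr n)"
  using vec.cr_add[OF vec.zero] by simp

lemma vec_add: "vec x \<Longrightarrow> vec y \<Longrightarrow> vec (x + y)"
  by (induction rule: vec.induct) (auto simp: add.assoc intro: vec.cr_add)

lemma vec_sum: "(\<And>s. s \<in> S \<Longrightarrow> vec (f s)) \<Longrightarrow> vec (sum f S)"
  by (induction S rule: infinite_finite_induct) (auto intro: vec.zero vec_add)

lemma vec_odd: "vec x \<Longrightarrow> odd_op x"
  by (induction rule: vec.induct) (auto intro: odd_op_zero odd_op_add odd_op_cr)

lemma vec_anticommute:
  assumes "vec x" "vec y" shows "x * y = - (y * x)"
  using assms(2)
proof (induction rule: vec.induct)
  case (cr_add y n)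
  have "x * cr n = - (cr n * x)" using vec_odd[OF assms(1)] by (simp add: odd_op_def)
  then show ?case using cr_add by (simp add: algebra_simps)
qed simp

text \<open>In characteristic 2 anticommutativity does not give this; the induction rests on
  \<open>cr_square\<close>, and the mixed terms cancel in pairs.\<close>

lemma vec_square:
  assumes "vec x" shows "x * x = 0"
  using assms
proof (induction rule: vec.induct)
  case (cr_add x n)
  have "x * cr n = - (cr n * x)" using vec_odd[OF cr_add.hyps] by (simp add: odd_op_def)
  then show ?case using cr_add by (simp add: algebra_simps cr_square)
qed simp

lemma even_op_vec:
  assumes "even_op x" "vec y" shows "x * y = y * x"
  using assms(2,1)
  by (induction rule: vec.induct) (auto simp: algebra_simps even_op_def)

lemma even_op_vec2: "vec x \<Longrightarrow> vec y \<Longrightarrow> even_op (x * y)"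
  by (simp add: even_op_odd_mult vec_odd)

lemma even_op_commute_vec2:
  assumes "even_op x" "vec a" "vec b" shows "x * (a * b) = a * b * x"
  by (intro commute_mult even_op_vec assms)

text \<open>Here \<open>a\<close>, \<open>b\<close> are the epsilon vectors and \<open>c\<close>,
  \<open>d\<close> the eta vectors of two elements; this is the factor that appears when the two are
  interchanged.\<close>

definition twist :: "'a \<Rightarrow> 'a \<Rightarrow> 'a \<Rightarrow> 'a \<Rightarrow> 'a::{ring,monoid_mult}" where
  "twist a b c d = (1 + a * b) * (1 + c * d)"

lemma even_op_twist: "vec a \<Longrightarrow> vec b \<Longrightarrow> vec c \<Longrightarrow> vec d \<Longrightarrow> even_op (twist a b c d)"
  by (simp add: twist_def even_op_mult even_op_add even_op_one even_op_vec2)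

lemma even_op_commute_twist:
  assumes "even_op x" "vec a" "vec b" "vec c" "vec d"
  shows "x * twist a b c d = twist a b c d * x"
proof -
  have *: "x * (1 + a * b) = (1 + a * b) * x" if "vec a" "vec b" for a b
    using even_op_commute_vec2[OF assms(1) that] by (simp add: distrib_left distrib_right)
  show ?thesis unfolding twist_def by (intro commute_mult * assms)
qed

text \<open>The cross term contains \<open>a\<close> twice and vanishes. Together with
  \<open>one_plus_vec_mult_left\<close> this makes \<open>twist\<close> bimultiplicative.\<close>

lemma one_plus_vec_mult:
  assumes "vec a" "vec b" "vec b'"
  shows "(1 + a * b) * (1 + a * b') = 1 + a * (b + b')"
proof -
  have "a * b * (a * b') = a * (b * a) * b'" by (simp add: mult.assoc)
  also have "\<dots> = - (a * a * b * b')"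
    unfolding vec_anticommute[OF assms(2,1)] by (simp add: mult.assoc)
  also have "\<dots> = 0" using vec_square[OF assms(1)] by simp
  finally show ?thesis by (simp add: algebra_simps)
qed

lemma one_plus_vec_mult_left:
  assumes "vec a" "vec a'" "vec b"
  shows "(1 + a * b) * (1 + a' * b) = 1 + (a + a') * b"
proof -
  have "a * b * (a' * b) = a * (b * a') * b" by (simp add: mult.assoc)
  also have "\<dots> = - (a * a' * (b * b))"
    unfolding vec_anticommute[OF assms(3,2)] by (simp add: mult.assoc)
  also have "\<dots> = 0" using vec_square[OF assms(3)] by simp
  finally show ?thesis by (simp add: algebra_simps)
qed

lemma twist_add_right:
  assumes "vec a" "vec b" "vec b'" "vec c" "vec d" "vec d'"
  shows "twist a (b + b') c (d + d') = twist a b c d * twist a b' c d'"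
proof -
  have "(1 + a * b') * (1 + c * d) = (1 + c * d) * (1 + a * b')"
    using even_op_commute_vec2[OF even_op_vec2[OF assms(1,3)] assms(4,5)]
    by (simp add: algebra_simps)
  then show ?thesis
    unfolding twist_def one_plus_vec_mult[OF assms(1-3), symmetric]
      one_plus_vec_mult[OF assms(4-6), symmetric]
    by (rule mult_interchange)
qed

lemma twist_add_left:
  assumes "vec a" "vec a'" "vec b" "vec c" "vec c'" "vec d"
  shows "twist (a + a') b (c + c') d = twist a b c d * twist a' b c' d"
proof -
  have "(1 + a' * b) * (1 + c * d) = (1 + c * d) * (1 + a' * b)"
    using even_op_commute_vec2[OF even_op_vec2[OF assms(2,3)] assms(4,6)]
    by (simp add: algebra_simps)
  then show ?thesis
    unfolding twist_def one_plus_vec_mult_left[OF assms(1-3), symmetric]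
      one_plus_vec_mult_left[OF assms(4-6), symmetric]
    by (rule mult_interchange)
qed

section \<open>Generators commuting up to exterior scalars\<close>

text \<open>A function \<open>f\<close> on sets of letters stands for a combination of increasing
  monomials, \<open>f T\<close> being the exterior coefficient of the monomial on
  \<open>T\<close>.\<close>

definition lft :: "(nat set \<Rightarrow> 'f::field) endo \<Rightarrow> (nat set \<Rightarrow> nat set \<Rightarrow> 'f) endo" where
  "lft x = Endo (\<lambda>f T. app x (f T))"

lemma app_lft [simp]: "app (lft x) f T = app x (f T)"
  unfolding lft_def by (subst Endo_inverse) (auto simp: fun_eq_iff)

lemma lft_hom:
  "lft (x + y) = lft x + lft y" "lft (x * y) = lft x * lft y" "lft 0 = 0" "lft 1 = 1"
  "lft (x - y) = lft x - lft y"
  by (rule endo_eqI; simp add: fun_eq_iff)+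

text \<open>The terms \<open>a * b\<close> and \<open>b * a\<close> cancel, and their product
  contains a square. The relation between two generators can thus be reversed.\<close>

lemma twist_inverse:
  assumes "vec a" "vec b" "vec c" "vec d"
  shows "twist a b c d * twist b a d c = 1"
proof -
  have inv: "(1 + x * y) * (1 + y * x) = 1" if "vec x" "vec y" for x y :: "(nat set \<Rightarrow> 'f::field) endo"
  proof -
    have "x * y * (y * x) = x * (y * y) * x" by (simp add: mult.assoc)
    then have "x * y * (y * x) = 0" using vec_square[OF that(2)] by simp
    moreover have "x * y + y * x = 0" using vec_anticommute[OF that] by simp
    ultimately show ?thesis by (simp add: algebra_simps)
  qed
  have "(1 + c * d) * (1 + b * a) = (1 + b * a) * (1 + c * d)"
    using even_op_commute_vec2[OF even_op_vec2[OF assms(3,4)] assms(2,1)]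
    by (simp add: algebra_simps)
  then have "twist a b c d * twist b a d c
      = ((1 + a * b) * (1 + b * a)) * ((1 + c * d) * (1 + d * c))"
    unfolding twist_def by (rule mult_interchange)
  then show ?thesis by (simp only: inv[OF assms(1,2)] inv[OF assms(3,4)] mult_1_left)
qed

text \<open>\<open>M\<close> holds the letters with nonzero eta vector, \<open>L\<close> those with
  nonzero generator. Finiteness of \<open>M\<close> bounds the eta degree; finiteness of
  \<open>L\<close> leaves finitely many nonzero words.\<close>

locale twisted_letters =
  fixes M L :: "nat set" and F_type :: "'f::field itself"
  assumes finite_M: "finite M" and finite_L: "finite L"
begin

text \<open>Even indices here and odd ones for \<open>eta\<close> keep the two families
  independent.\<close>

definition eps :: "nat \<Rightarrow> (nat set \<Rightarrow> 'f) endo" where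
  "eps i = cr (2 * i)"

definition eta :: "nat \<Rightarrow> (nat set \<Rightarrow> 'f) endo" where
  "eta i = (if i \<in> M then cr (2 * i + 1) else 0)"

text \<open>
  The product of all \<open>(1 + \<epsilon>\<^sub>i \<epsilon>\<^sub>j) (1 + \<eta>\<^sub>i \<eta>\<^sub>j)\<close> over \<open>j \<in> T\<close>, \<open>j < i\<close>: the factor picked up when
  \<open>x\<^sub>i\<close> is moved to its place in the increasing monomial on \<open>T\<close>.
\<close>

definition theta :: "nat \<Rightarrow> nat set \<Rightarrow> (nat set \<Rightarrow> 'f) endo" where
  "theta i T = twist (eps i) (\<Sum>j | j \<in> T \<and> j < i. eps j) (eta i) (\<Sum>j | j \<in> T \<and> j < i. eta j)"

text \<open>Multiplying the monomial on \<open>T - {i}\<close> by the letter \<open>i\<close> gives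
  the one on \<open>T\<close> up to \<open>theta\<close>; a monomial already containing
  \<open>i\<close> is sent to 0.\<close>

definition gen :: "nat \<Rightarrow> (nat set \<Rightarrow> nat set \<Rightarrow> 'f) endo" where
  "gen i = Endo (\<lambda>f T. if i \<in> T \<and> i \<in> L then app (theta i T) (f (T - {i})) else 0)"

lemma app_gen:
  "app (gen i) f T = (if i \<in> T \<and> i \<in> L then app (theta i T) (f (T - {i})) else 0)"
  unfolding gen_def by (subst Endo_inverse) (auto simp: fun_eq_iff)

lemma vec_eps: "vec (eps i)"
  by (simp add: eps_def vec_cr)

lemma vec_eta: "vec (eta i)"
  by (simp add: eta_def vec_cr vec.zero)

lemma even_op_theta: "even_op (theta i T)"
  unfolding theta_def by (intro even_op_twist vec_sum vec_eps vec_eta)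

lemma even_op_commute_theta: "even_op x \<Longrightarrow> x * theta i T = theta i T * x"
  unfolding theta_def by (intro even_op_commute_twist vec_sum vec_eps vec_eta)

lemma theta_remove:
  assumes "j \<in> T" "j < i"
  shows "theta i T = twist (eps i) (eps j) (eta i) (eta j) * theta i (T - {j})"
proof -
  have "{x. x \<in> T \<and> x < i} = insert j {x. x \<in> T - {j} \<and> x < i}" using assms by auto
  then have "(\<Sum>x | x \<in> T \<and> x < i. g x) = g j + (\<Sum>x | x \<in> T - {j} \<and> x < i. g x)"
    for g :: "nat \<Rightarrow> (nat set \<Rightarrow> 'f) endo"
    by (simp only:) (subst sum.insert; simp)
  then show ?thesis unfolding theta_def
    by (simp only: twist_add_right vec_eps vec_eta vec_sum)
qed

text \<open>Only smaller letters enter \<open>theta\<close>: the presence of \<open>i\<close> does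
  not change the factor of \<open>j\<close>, while \<open>j\<close> contributes exactly one twist to
  the factor of \<open>i\<close>.\<close>

lemma gen_commute_less:
  assumes "j < i"
  shows "gen i * gen j = lft (twist (eps i) (eps j) (eta i) (eta j)) * gen j * gen i"
proof (rule endo_eqI, rule ext)
  fix f :: "nat set \<Rightarrow> nat set \<Rightarrow> 'f" and T
  let ?q = "twist (eps i) (eps j) (eta i) (eta j) :: (nat set \<Rightarrow> 'f) endo"
  show "app (gen i * gen j) f T = app (lft ?q * gen j * gen i) f T"
  proof (cases "i \<in> T \<and> j \<in> T \<and> i \<in> L \<and> j \<in> L")
    case True
    have "{x \<in> T - {i}. x < j} = {x \<in> T. x < j}" using assms by auto
    then have "theta j (T - {i}) = (theta j T :: (nat set \<Rightarrow> 'f) endo)"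
      by (simp add: theta_def)
    then have "theta i T * theta j (T - {i}) = ?q * theta i (T - {j}) * theta j T"
      using theta_remove[OF _ assms, of T] True by simp
    also have "\<dots> = ?q * (theta j T * theta i (T - {j}))"
      using even_op_commute_theta[OF even_op_theta[of i "T - {j}"], of j T] by (simp only: mult.assoc)
    finally have *: "theta i T * theta j (T - {i}) = ?q * (theta j T * theta i (T - {j}))" .
    have "app (theta i T) (app (theta j (T - {i})) g)
        = app ?q (app (theta j T) (app (theta i (T - {j})) g))" for g
      using arg_cong[OF *, of "\<lambda>x. app x g"] by (simp only: app_endo_ops)
    moreover have "T - {i} - {j} = T - {j} - {i}" by auto
    ultimately show ?thesis using True assms by (simp add: app_gen)
  qed (auto simp: app_gen)
qed

lemma gen_commute: "gen i * gen j = lft (twist (eps i) (eps j) (eta i) (eta j)) * gen j * gen i"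
proof (cases i j rule: linorder_cases)
  case less
  have "lft (twist (eps i) (eps j) (eta i) (eta j)) * gen j * gen i
    = lft (twist (eps i) (eps j) (eta i) (eta j)) * (gen j * gen i)" by (simp add: mult.assoc)
  also have "\<dots> = lft (twist (eps i) (eps j) (eta i) (eta j) * twist (eps j) (eps i) (eta j) (eta i))
      * (gen i * gen j)"
    unfolding gen_commute_less[OF less] by (simp add: lft_hom mult.assoc)
  finally show ?thesis by (simp only: twist_inverse vec_eps vec_eta lft_hom mult_1_left)
next
  case equal
  then show ?thesis by (simp add: twist_def vec_square vec_eps vec_eta lft_hom)
next
  case greater
  then show ?thesis by (rule gen_commute_less)
qed

lemma gen_lft: "even_op x \<Longrightarrow> gen i * lft x = lft x * gen i"
proof (rule endo_eqI, rule ext)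
  fix f T
  assume "even_op x"
  then have "app (x * theta i T) g = app (theta i T * x) g" for g
    by (simp only: even_op_commute_theta)
  then show "app (gen i * lft x) f T = app (lft x * gen i) f T"
    by (simp add: app_gen)
qed

section \<open>Words and their commutation factors\<close>

definition word :: "nat list \<Rightarrow> (nat set \<Rightarrow> nat set \<Rightarrow> 'f) endo" where
  "word w = prod_list (map gen w)"

definition weps :: "nat list \<Rightarrow> (nat set \<Rightarrow> 'f) endo" where
  "weps w = sum_list (map eps w)"

definition weta :: "nat list \<Rightarrow> (nat set \<Rightarrow> 'f) endo" where
  "weta w = sum_list (map eta w)"

lemma word_simps [simp]: "word [] = 1" "word (i # w) = gen i * word w" "word (u @ v) = word u * word v"
  by (simp_all add: word_def)

lemma weps_simps [simp]: "weps [] = 0" "weps (i # w) = eps i + weps w" "weps (u @ v) = weps u + weps v"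
  by (simp_all add: weps_def)

lemma weta_simps [simp]: "weta [] = 0" "weta (i # w) = eta i + weta w" "weta (u @ v) = weta u + weta v"
  by (simp_all add: weta_def)

lemma vec_weps: "vec (weps w)"
  by (induction w) (auto intro: vec.zero vec_add vec_eps)

lemma vec_weta: "vec (weta w)"
  by (induction w) (auto intro: vec.zero vec_add vec_eta)

definition wtwist :: "nat list \<Rightarrow> nat list \<Rightarrow> (nat set \<Rightarrow> 'f) endo" where
  "wtwist u v = twist (weps u) (weps v) (weta u) (weta v)"

lemma even_op_wtwist: "even_op (wtwist u v)"
  unfolding wtwist_def by (intro even_op_twist vec_weps vec_weta)

lemma wtwist_Cons_left: "wtwist (i # u) v = wtwist [i] v * wtwist u v"
  by (simp add: wtwist_def twist_add_left vec_weps vec_weta vec_eps vec_eta)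

lemma wtwist_Cons_right: "wtwist u (i # v) = wtwist u [i] * wtwist u v"
  by (simp add: wtwist_def twist_add_right vec_weps vec_weta vec_eps vec_eta)

lemma wtwist_Nil: "wtwist [] v = 1" "wtwist u [] = 1"
  by (simp_all add: wtwist_def twist_def)

lemma wtwist_commute: "wtwist u v * wtwist u' v' = wtwist u' v' * wtwist u v"
  unfolding wtwist_def[of u' v']
  by (intro even_op_commute_twist even_op_wtwist vec_weps vec_weta)

lemma word_lft: "even_op x \<Longrightarrow> word w * lft x = lft x * word w"
proof (induction w)
  case (Cons i w)
  have "gen i * word w * lft x = gen i * lft x * word w" using Cons by (simp add: mult.assoc)
  also have "\<dots> = lft x * gen i * word w" using Cons by (simp add: gen_lft)
  finally show ?case by (simp add: mult.assoc)
qed simp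

lemma gen_word: "gen i * word v = lft (wtwist [i] v) * word v * gen i"
proof (induction v)
  case (Cons j v)
  have "gen i * word (j # v) = (gen i * gen j) * word v" by (simp add: mult.assoc)
  also have "\<dots> = lft (wtwist [i] [j]) * gen j * (gen i * word v)"
    by (subst gen_commute) (simp add: mult.assoc wtwist_def)
  also have "\<dots> = lft (wtwist [i] [j]) * (gen j * lft (wtwist [i] v)) * word v * gen i"
    by (simp add: Cons mult.assoc)
  also have "\<dots> = lft (wtwist [i] (j # v)) * word (j # v) * gen i"
    by (simp add: gen_lft even_op_wtwist wtwist_Cons_right[of _ j v] lft_hom mult.assoc)
  finally show ?case .
qed (simp add: wtwist_Nil lft_hom)

text \<open>The letters of \<open>u\<close> pass \<open>v\<close> one at a time, and the factors
  combine because \<open>wtwist\<close> is multiplicative in each argument.\<close>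

lemma word_commute: "word u * word v = lft (wtwist u v) * (word v * word u)"
proof (induction u)
  case (Cons i u)
  have "word (i # u) * word v = gen i * lft (wtwist u v) * word v * word u"
    by (simp add: Cons mult.assoc)
  also have "\<dots> = lft (wtwist u v) * (gen i * word v) * word u"
    by (simp add: gen_lft even_op_wtwist mult.assoc)
  also have "\<dots> = lft (wtwist u v) * lft (wtwist [i] v) * (word v * (gen i * word u))"
    by (simp add: gen_word mult.assoc)
  also have "lft (wtwist u v) * lft (wtwist [i] v) = lft (wtwist (i # u) v)"
    by (simp add: wtwist_Cons_left[of i u] wtwist_commute flip: lft_hom)
  finally show ?case by simp
qed (simp add: wtwist_Nil lft_hom)

text \<open>Each generator requires its letter in \<open>T\<close> and removes it, so a repeated
  letter is missing the second time.\<close>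

lemma word_eq_0:
  assumes "\<not> (distinct w \<and> set w \<subseteq> L)"
  shows "word w = 0"
proof -
  have "app (word w) f T = 0" if "\<not> (distinct w \<and> set w \<subseteq> T \<inter> L)" for f :: "nat set \<Rightarrow> nat set \<Rightarrow> 'f" and T
    using that
  proof (induction w arbitrary: T)
    case (Cons i w)
    show ?case
    proof (cases "i \<in> T \<inter> L")
      case True
      then have "\<not> (distinct w \<and> set w \<subseteq> (T - {i}) \<inter> L)" using Cons.prems by auto
      then have "app (word w) f (T - {i}) = 0" by (rule Cons.IH)
      then show ?thesis by (simp only: word_simps app_endo_ops app_gen app_zero if_cancel)
    qed (auto simp: app_gen)
  qed simp
  then show ?thesis using assms by (intro endo_eqI ext) auto
qed

end

section \<open>Vanishing of long commutators\<close>

definition bracket :: "'a::ring \<Rightarrow> 'a \<Rightarrow> 'a" where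
  "bracket a b = a * b - b * a"

lemma bracket_zero [simp]: "bracket 0 b = 0" "bracket a 0 = 0"
  by (simp_all add: bracket_def)

lemma bracket_add: "bracket (a + a') b = bracket a b + bracket a' b" "bracket a (b + b') = bracket a b + bracket a b'"
  by (simp_all add: bracket_def algebra_simps)

fun bracket_rev :: "'a::ring list \<Rightarrow> 'a" where
  "bracket_rev [] = 0"
| "bracket_rev [a] = a"
| "bracket_rev (a # as) = bracket (bracket_rev as) a"

lemma bracket_rev_Cons: "as \<noteq> [] \<Longrightarrow> bracket_rev (a # as) = bracket (bracket_rev as) a"
  by (cases as) auto

inductive_set add_span :: "'a::ab_group_add set \<Rightarrow> 'a set" for S where
  zero: "0 \<in> add_span S"
| add: "a \<in> S \<Longrightarrow> b \<in> add_span S \<Longrightarrow> a + b \<in> add_span S"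

lemma add_span_base: "a \<in> S \<Longrightarrow> a \<in> add_span S"
  using add_span.add[OF _ add_span.zero] by force

lemma add_span_add: "a \<in> add_span S \<Longrightarrow> b \<in> add_span S \<Longrightarrow> a + b \<in> add_span S"
  by (induction rule: add_span.induct) (auto simp: add.assoc intro: add_span.add)

lemma add_span_sum: "(\<And>x. x \<in> X \<Longrightarrow> f x \<in> add_span S) \<Longrightarrow> sum f X \<in> add_span S"
  by (induction X rule: infinite_finite_induct) (auto intro: add_span.zero add_span_add)

lemma bracket_add_span:
  assumes "\<And>a b. a \<in> S \<Longrightarrow> b \<in> S' \<Longrightarrow> bracket a b \<in> add_span U"
    and "a \<in> add_span S" "b \<in> add_span S'"
  shows "bracket a b \<in> add_span U"
  using assms(2)
proof (induction rule: add_span.induct)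
  case (add a c)
  have "bracket a b \<in> add_span U"
    using assms(3) by (induction rule: add_span.induct)
      (auto simp: bracket_add intro: add_span.zero add_span_add assms(1)[OF add.hyps(1)])
  then show ?case using add.IH by (auto simp: bracket_add intro: add_span_add)
qed (auto intro: add_span.zero)

context twisted_letters
begin

definition etaset :: "nat set" where
  "etaset = (\<lambda>i. 2 * i + 1) ` M"

text \<open>Operators that raise the degree in the \<open>\<eta>\<close>'s by at least \<open>d\<close>.\<close>

definition fil :: "nat \<Rightarrow> (nat set \<Rightarrow> 'f) endo set" where
  "fil d = {x. \<forall>c f. (\<forall>J. card (J \<inter> etaset) < c \<longrightarrow> f J = 0) \<longrightarrow>
      (\<forall>J. card (J \<inter> etaset) < c + d \<longrightarrow> app x f J = 0)}"

lemma filD: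
  "x \<in> fil d \<Longrightarrow> (\<And>J. card (J \<inter> etaset) < c \<Longrightarrow> f J = 0) \<Longrightarrow> card (J \<inter> etaset) < c + d \<Longrightarrow> app x f J = 0"
  unfolding fil_def by blast

lemma filI:
  "(\<And>c f J. (\<And>J. card (J \<inter> etaset) < c \<Longrightarrow> f J = 0) \<Longrightarrow> card (J \<inter> etaset) < c + d \<Longrightarrow> app x f J = 0) \<Longrightarrow> x \<in> fil d"
  unfolding fil_def by blast

lemma finite_etaset: "finite etaset"
  by (simp add: etaset_def finite_M)

lemma card_etaset: "card etaset = card M"
  unfolding etaset_def by (rule card_image) (auto simp: inj_on_def)

lemma fil_zero: "0 \<in> fil d"
  by (rule filI) simp

lemma fil_one: "1 \<in> fil 0"
  by (rule filI) simp

lemma fil_add: "x \<in> fil d \<Longrightarrow> y \<in> fil d \<Longrightarrow> x + y \<in> fil d"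
  by (simp add: fil_def)

lemma fil_mono: "x \<in> fil d \<Longrightarrow> e \<le> d \<Longrightarrow> x \<in> fil e"
  unfolding fil_def by (blast intro: less_le_trans add_left_mono)

lemma fil_mult:
  assumes "x \<in> fil d" "y \<in> fil e"
  shows "x * y \<in> fil (d + e)"
proof (rule filI)
  fix c f J
  assume f: "\<And>J. card (J \<inter> etaset) < c \<Longrightarrow> f J = (0::'f)" and J: "card (J \<inter> etaset) < c + (d + e)"
  have "app x (app y f) J = 0"
    by (rule filD[OF assms(1), of "c + e"]) (use filD[OF assms(2) f] J in auto)
  then show "app (x * y) f J = 0" by simp
qed

lemma fil_sc: "sc c \<in> fil 0"
  by (rule filI) (simp add: app_sc)

lemma fil_cr: "cr n \<in> fil 0"
proof (rule filI)
  fix c f J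
  assume f: "\<And>J. card (J \<inter> etaset) < c \<Longrightarrow> f J = (0::'f)" and J: "card (J \<inter> etaset) < c + 0"
  have "card ((J - {n}) \<inter> etaset) \<le> card (J \<inter> etaset)"
    by (rule card_mono) (auto simp: finite_etaset)
  then show "app (cr n) f J = 0" using f J by (simp add: app_cr)
qed

lemma fil_eta: "eta i \<in> fil 1"
proof (cases "i \<in> M")
  case True
  show ?thesis
  proof (rule filI)
    fix c f J
    assume f: "\<And>J. card (J \<inter> etaset) < c \<Longrightarrow> f J = (0::'f)" and J: "card (J \<inter> etaset) < c + 1"
    have "f (J - {2 * i + 1}) = 0" if "2 * i + 1 \<in> J"
    proof (rule f)
      have "2 * i + 1 \<in> J \<inter> etaset" using that True by (auto simp: etaset_def)
      moreover have "(J - {2 * i + 1}) \<inter> etaset = (J \<inter> etaset) - {2 * i + 1}" by auto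
      ultimately show "card ((J - {2 * i + 1}) \<inter> etaset) < c"
        using J finite_etaset card_Diff1_less[of "J \<inter> etaset" "2 * i + 1"] by simp
    qed
    then show "app (eta i) f J = 0" using True by (simp add: eta_def app_cr)
  qed
qed (simp add: eta_def fil_zero)

lemma fil_weps: "weps w \<in> fil 0"
  by (induction w) (auto simp: eps_def intro: fil_zero fil_add fil_cr)

lemma fil_weta: "weta w \<in> fil 1"
  by (induction w) (simp_all add: fil_zero fil_add fil_eta del: One_nat_def)

text \<open>For \<open>c = 0\<close> the premise in \<open>fil\<close> is vacuous, so
  \<open>app x f\<close> is supported on sets with at least \<open>d\<close> eta indices, and only
  \<open>card M\<close> are available.\<close>

lemma fil_eq_0:
  assumes "x \<in> fil d" "card M < d" shows "x = 0"
proof (rule endo_eqI, rule ext)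
  fix f J
  have "card (J \<inter> etaset) \<le> card etaset" by (rule card_mono) (auto simp: finite_etaset)
  then show "app x f J = app 0 f J"
    using filD[OF assms(1), of 0 f J] assms(2) by (simp add: card_etaset)
qed

text \<open>
  \<open>eps_terms\<close> and \<open>eta_terms\<close> hold the commutators whose last factor is \<open>a\<close>, respectively \<open>b\<close>;
  bracketing with a monomial interchanges the two kinds.
\<close>

definition eps_terms :: "nat \<Rightarrow> (nat set \<Rightarrow> nat set \<Rightarrow> 'f) endo set" where
  "eps_terms d = {lft x * word w | x w. even_op x \<and> x \<in> fil d \<and> x * weps w = 0}"

definition eta_terms :: "nat \<Rightarrow> (nat set \<Rightarrow> nat set \<Rightarrow> 'f) endo set" where
  "eta_terms d = {lft x * word w | x w. even_op x \<and> x \<in> fil d \<and> x * weta w = 0}"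

definition mono_terms :: "(nat set \<Rightarrow> nat set \<Rightarrow> 'f) endo set" where
  "mono_terms = {lft (sc c) * word w | c w. True}"

text \<open>Both products are multiples of \<open>word (v @ w)\<close>, and their coefficients
  differ by the factor \<open>wtwist w v\<close>.\<close>

lemma bracket_words:
  assumes "even_op x" "even_op y" "x * y = y * x"
  shows "bracket (lft x * word w) (lft y * word v) = lft (x * y * (wtwist w v - 1)) * word (v @ w)"
proof -
  have "lft x * word w * (lft y * word v) = lft x * lft y * (word w * word v)"
    by (rule mult_interchange) (rule word_lft[OF assms(2)])
  also have "\<dots> = lft (x * y * wtwist w v) * word (v @ w)"
    by (subst word_commute) (simp add: lft_hom mult.assoc)
  finally have 1: "lft x * word w * (lft y * word v) = \<dots>" .
  have "lft y * word v * (lft x * word w) = lft y * lft x * (word v * word w)"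
    by (rule mult_interchange) (rule word_lft[OF assms(1)])
  then have 2: "lft y * word v * (lft x * word w) = lft (x * y) * word (v @ w)"
    using assms(3) by (simp flip: lft_hom)
  show ?thesis unfolding bracket_def 1 2 by (simp add: right_diff_distrib lft_hom left_diff_distrib)
qed

text \<open>This is \<open>a + b + a b\<close>, grouped so that everything but the last summand
  begins with \<open>weps w\<close>.\<close>

lemma wtwist_minus_one:
  "wtwist w v - 1 = weps w * weps v * (1 + weta w * weta v) + weta w * weta v"
  by (simp add: wtwist_def twist_def algebra_simps)

text \<open>The factor contributed by \<open>w\<close> and \<open>v\<close> kills the vector of
  \<open>v @ w\<close>; this is the annihilation condition that \<open>eps_terms\<close> and
  \<open>eta_terms\<close> impose on the new coefficient.\<close>

lemma vec_product_kills_sum: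
  assumes "vec a" "vec b"
  shows "a * b * (b + a) = 0"
proof -
  have "a * b * (b + a) = a * (b * b) + a * (b * a)" by (simp add: distrib_left mult.assoc)
  also have "a * (b * a) = - (a * a * b)"
    using vec_anticommute[OF assms(2,1)] by (simp add: mult.assoc)
  finally show ?thesis using vec_square[OF assms(1)] vec_square[OF assms(2)] by simp
qed

lemma even_op_weps2: "even_op (weps w * weps v)"
  by (intro even_op_vec2 vec_weps)

lemma even_op_weta2: "even_op (weta w * weta v)"
  by (intro even_op_vec2 vec_weta)

lemma weta2_weps2_commute: "weta w * weta v * (weps w' * weps v') = weps w' * weps v' * (weta w * weta v)"
  by (intro even_op_commute_vec2 even_op_weta2 vec_weps)

lemma fil_weps2: "weps w * weps v \<in> fil 0"
  using fil_mult[OF fil_weps fil_weps] by simp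

lemma fil_weta2: "weta w * weta v \<in> fil 2"
  using fil_mult[OF fil_weta fil_weta] by (simp add: numeral_2_eq_2)

text \<open>As \<open>x\<close> kills \<open>weps w\<close>, only the eta part of the commutation
  factor survives, and its two vectors raise the degree by 2.\<close>

lemma bracket_eps_terms:
  assumes "a \<in> eps_terms d" "b \<in> mono_terms"
  shows "bracket a b \<in> eta_terms (d + 2)"
proof -
  obtain x w where a: "a = lft x * word w" and x: "even_op x" "x \<in> fil d" "x * weps w = 0"
    using assms(1) by (auto simp: eps_terms_def)
  obtain c v where b: "b = lft (sc c) * word v" using assms(2) by (auto simp: mono_terms_def)
  have xc: "x * sc c = sc c * x" using x(1) by (simp add: even_op_def)
  have "x * sc c * (wtwist w v - 1)
      = sc c * (x * weps w * weps v * (1 + weta w * weta v) + x * (weta w * weta v))"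
    unfolding wtwist_minus_one xc by (simp add: distrib_left mult.assoc)
  then have "bracket a b = lft (sc c * (x * (weta w * weta v))) * word (v @ w)"
    unfolding a b bracket_words[OF x(1) even_op_sc xc] using x(3) by simp
  moreover have "even_op (sc c * (x * (weta w * weta v)))"
    by (intro even_op_mult even_op_sc x even_op_weta2)
  moreover have "sc c * (x * (weta w * weta v)) \<in> fil (d + 2)"
    using fil_mult[OF fil_sc fil_mult[OF x(2) fil_weta2]] by simp
  moreover have "sc c * (x * (weta w * weta v)) * weta (v @ w) = 0"
    using vec_product_kills_sum[OF vec_weta vec_weta, of w v] by (simp add: mult.assoc)
  ultimately show ?thesis unfolding eta_terms_def by blast
qed

lemma bracket_eta_terms:
  assumes "a \<in> eta_terms d" "b \<in> mono_terms"
  shows "bracket a b \<in> eps_terms d"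
proof -
  obtain x w where a: "a = lft x * word w" and x: "even_op x" "x \<in> fil d" "x * weta w = 0"
    using assms(1) by (auto simp: eta_terms_def)
  obtain c v where b: "b = lft (sc c) * word v" using assms(2) by (auto simp: mono_terms_def)
  have xc: "x * sc c = sc c * x" using x(1) by (simp add: even_op_def)
  \<comment> \<open>The eta part is moved to the front of its terms, where \<open>x\<close> kills
    it; the remaining epsilon part leaves the degree bound unchanged.\<close>
  have "wtwist w v - 1 = weps w * weps v + weta w * weta v * (weps w * weps v + 1)"
    unfolding wtwist_minus_one by (simp add: distrib_left weta2_weps2_commute)
  then have "x * sc c * (wtwist w v - 1)
      = sc c * (x * (weps w * weps v) + x * weta w * weta v * (weps w * weps v + 1))"
    unfolding xc by (simp only: distrib_left mult.assoc)
  then have "bracket a b = lft (sc c * (x * (weps w * weps v))) * word (v @ w)"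
    unfolding a b bracket_words[OF x(1) even_op_sc xc] using x(3) by simp
  moreover have "even_op (sc c * (x * (weps w * weps v)))"
    by (intro even_op_mult even_op_sc x even_op_weps2)
  moreover have "sc c * (x * (weps w * weps v)) \<in> fil d"
    using fil_mult[OF fil_sc fil_mult[OF x(2) fil_weps2]] by simp
  moreover have "sc c * (x * (weps w * weps v)) * weps (v @ w) = 0"
    using vec_product_kills_sum[OF vec_weps vec_weps, of w v] by (simp add: mult.assoc)
  ultimately show ?thesis unfolding eps_terms_def by blast
qed

text \<open>Nothing is killed in the first bracket: \<open>a (1 + b)\<close> gives an epsilon term
  and \<open>b\<close> an eta term.\<close>

lemma bracket_mono_terms:
  assumes "a \<in> mono_terms" "b \<in> mono_terms"
  shows "bracket a b \<in> add_span (eps_terms 0 \<union> eta_terms 2)"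
proof -
  obtain c w where a: "a = lft (sc c) * word w" using assms(1) by (auto simp: mono_terms_def)
  obtain d v where b: "b = lft (sc d) * word v" using assms(2) by (auto simp: mono_terms_def)
  let ?x = "sc c * sc d * (weps w * weps v * (1 + weta w * weta v))"
  let ?y = "sc c * sc d * (weta w * weta v)"
  have "bracket a b = lft ?x * word (v @ w) + lft ?y * word (v @ w)"
    unfolding a b
    by (subst bracket_words)
      (simp_all add: even_op_sc wtwist_minus_one distrib_left distrib_right lft_hom mult.commute
        flip: sc_hom(2))
  moreover have "lft ?x * word (v @ w) \<in> eps_terms 0"
  proof -
    have "even_op ?x"
      by (intro even_op_mult even_op_sc even_op_add even_op_one even_op_weps2 even_op_weta2 vec_weps)
    moreover have "1 + weta w * weta v \<in> fil 0"
      by (intro fil_add fil_one fil_mono[OF fil_weta2]) simp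
    then have "?x \<in> fil (0 + 0 + (0 + 0))"
      by (intro fil_mult fil_sc fil_weps2)
    moreover have "?x * weps (v @ w) = 0"
    proof -
      have "?x * weps (v @ w) = sc c * sc d * (weps w * weps v * ((1 + weta w * weta v) * weps (v @ w)))"
        by (simp add: mult.assoc)
      also have "(1 + weta w * weta v) * weps (v @ w) = weps (v @ w) * (1 + weta w * weta v)"
        by (intro even_op_vec even_op_add even_op_one even_op_weta2 vec_weps)
      also have "sc c * sc d * (weps w * weps v * \<dots>)
          = sc c * sc d * ((weps w * weps v * weps (v @ w)) * (1 + weta w * weta v))"
        by (simp only: mult.assoc)
      finally show ?thesis using vec_product_kills_sum[OF vec_weps vec_weps, of w v] by simp
    qed
    ultimately show ?thesis unfolding eps_terms_def by fastforce
  qed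
  moreover have "lft ?y * word (v @ w) \<in> eta_terms 2"
  proof -
    have "even_op ?y" by (intro even_op_mult even_op_sc even_op_weta2)
    moreover have "?y \<in> fil 2"
      using fil_mult[OF fil_mult[OF fil_sc fil_sc] fil_weta2, of c d w v] by (simp only: add_0_left)
    moreover have "?y * weta (v @ w) = 0"
      using vec_product_kills_sum[OF vec_weta vec_weta, of w v] by (simp add: mult.assoc)
    ultimately show ?thesis unfolding eta_terms_def by blast
  qed
  ultimately show ?thesis by (simp only: add_span_add add_span_base Un_iff simp_thms)
qed

text \<open>A commutator of length \<open>j\<close> carries \<open>j - 1\<close> alternating
  factors. Those ending in epsilon contain at least \<open>(j - 1) div 2\<close> eta factors, those
  ending in eta at least \<open>j div 2\<close>, each of degree 2.\<close>

lemma bracket_rev_mono_terms: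
  assumes "length as \<ge> 2" "set as \<subseteq> add_span mono_terms"
  shows "bracket_rev as
    \<in> add_span (eps_terms (2 * ((length as - 1) div 2)) \<union> eta_terms (2 * (length as div 2)))"
  using assms
proof (induction as)
  case (Cons a as)
  show ?case
  proof (cases "length as \<ge> 2")
    case True
    let ?j = "length as"
    have IH: "bracket_rev as \<in> add_span (eps_terms (2 * ((?j - 1) div 2)) \<union> eta_terms (2 * (?j div 2)))"
      using Cons True by simp
    have j: "2 * ((?j - 1) div 2) + 2 = 2 * (length (a # as) div 2)"
      "2 * (?j div 2) = 2 * ((length (a # as) - 1) div 2)"
      using True by (cases as; simp)+
    have "bracket (bracket_rev as) a
      \<in> add_span (eps_terms (2 * (?j div 2)) \<union> eta_terms (2 * ((?j - 1) div 2) + 2))"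
    proof (rule bracket_add_span[OF _ IH])
      show "a \<in> add_span mono_terms" using Cons.prems by simp
    qed (blast intro: add_span_base bracket_eps_terms bracket_eta_terms)
    moreover have "bracket_rev (a # as) = bracket (bracket_rev as) a"
      using True by (intro bracket_rev_Cons) auto
    ultimately show ?thesis unfolding j by simp
  next
    case False
    then obtain b where "as = [b]" using Cons.prems by (cases as) (auto simp: Suc_le_eq)
    then show ?thesis
      using Cons.prems by (auto intro: bracket_add_span[OF bracket_mono_terms])
  qed
qed simp

lemma bracket_rev_eq_0:
  assumes "card M = 2 * n" "length as = 2 * n + 3" "set as \<subseteq> add_span mono_terms"
  shows "bracket_rev as = 0"
proof -
  \<comment> \<open>At length \<open>2 * n + 3\<close> both degrees are \<open>2 * n + 2\<close>,
    which exceeds the \<open>2 * n\<close> available eta vectors.\<close>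
  have "eps_terms (2 * n + 2) \<union> eta_terms (2 * n + 2) \<subseteq> {0}"
  proof -
    have "lft x * word w = 0" if "x \<in> fil (2 * n + 2)" for x w
      using fil_eq_0[OF that] assms(1) by (simp add: lft_hom)
    then show ?thesis by (auto simp: eps_terms_def eta_terms_def simp del: add_2_eq_Suc')
  qed
  moreover have "2 * ((length as - 1) div 2) = 2 * n + 2" "2 * (length as div 2) = 2 * n + 2"
    using assms(2) by simp_all
  moreover have "bracket_rev as
      \<in> add_span (eps_terms (2 * ((length as - 1) div 2)) \<union> eta_terms (2 * (length as div 2)))"
    by (rule bracket_rev_mono_terms) (use assms in auto)
  moreover have "a = 0" if "S \<subseteq> {0}" "a \<in> add_span S" for a :: "(nat set \<Rightarrow> nat set \<Rightarrow> 'f) endo" and S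
    using that(2,1) by (induction rule: add_span.induct) auto
  ultimately show ?thesis by metis
qed

end

section \<open>A nonvanishing product of commutators\<close>

lemma vec_empty: "vec x \<Longrightarrow> app x g {} = 0"
  by (induction rule: vec.induct) (simp_all add: app_cr)

lemma twist_empty:
  assumes "vec a" "vec b" "vec c" "vec d"
  shows "app (twist a b c d) g {} = g {}"
  using assms by (simp add: twist_def vec_empty)

lemma prod_cr_eval:
  assumes "distinct cs"
  shows "\<exists>s. s \<noteq> 0 \<and> app (prod_list (map cr cs)) g (set cs) = s * g {}"
  using assms
proof (induction cs)
  case Nil
  show ?case by (rule exI[of _ 1]) simp
next
  case (Cons c cs)
  then obtain s where s: "s \<noteq> 0" "app (prod_list (map cr cs)) g (set cs) = s * g {}" by auto
  have "insert c (set cs) - {c} = set cs" using Cons.prems by auto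
  then show ?case
    using s by (intro exI[of _ "(-1) ^ card {j \<in> set (c # cs). j < c} * s"]) (simp add: app_cr)
qed

lemma even_op_kills:
  assumes "even_op z" "vec v" "x * v = 0"
  shows "x * z * v = 0"
  using even_op_vec[OF assms(1,2)] assms(3) by (simp add: mult.assoc) (simp flip: mult.assoc)

lemma vec2_kills:
  assumes "vec a" "vec b"
  shows "x * (a * b) * a = 0" "x * (a * b) * b = 0"
proof -
  have "x * (a * b) * a = x * a * (b * a)" "x * (a * b) * b = x * a * (b * b)" by (simp_all add: mult.assoc)
  moreover have "x * a * (b * a) = - (x * (a * a) * b)"
    using vec_anticommute[OF assms(2,1)] by (simp add: mult.assoc)
  ultimately show "x * (a * b) * a = 0" "x * (a * b) * b = 0"
    using vec_square[OF assms(1)] vec_square[OF assms(2)] by simp_all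
qed

context twisted_letters
begin

text \<open>The empty exterior index picks out the constant term, and every \<open>theta\<close> has
  constant term 1.\<close>

lemma word_eval:
  assumes "distinct w" "set w \<subseteq> L"
  shows "app (word w) f (set w) {} = f {} {}"
  using assms
proof (induction w)
  case (Cons i w)
  have "insert i (set w) - {i} = set w" using Cons.prems by auto
  then show ?case using Cons
    by (simp add: app_gen theta_def twist_empty vec_eps vec_eta vec_sum)
qed simp

lemma prod_cr_word_nonzero:
  assumes "distinct cs" "distinct w" "set w \<subseteq> L"
  shows "lft (prod_list (map cr cs)) * word w \<noteq> 0"
proof
  assume 0: "lft (prod_list (map cr cs)) * word w = 0"
  \<comment> \<open>\<open>?f\<close> is the empty monomial with coefficient 1. Its image has the
    nonzero coefficient \<open>s\<close> at the monomial on \<open>set w\<close> and the wedge on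
    \<open>set cs\<close>.\<close>
  let ?f = "\<lambda>T J. if T = {} \<and> J = {} then 1 else 0 :: 'f"
  obtain s where s: "s \<noteq> 0"
    "app (prod_list (map cr cs)) (app (word w) ?f (set w)) (set cs) = s * app (word w) ?f (set w) {}"
    using prod_cr_eval[OF assms(1)] by blast
  have "app (lft (prod_list (map cr cs)) * word w) ?f (set w) (set cs) = s"
    using s(2) by (simp add: word_eval assms)
  then show False using s(1) unfolding 0 by simp
qed

text \<open>The coefficient of the left-normed commutator of the generators \<open>h 0\<close>, ...,
  \<open>h (2*t+1)\<close> when \<open>eta (h 0)\<close> vanishes; each recursion step accounts for
  one eta factor and one epsilon factor.\<close>

fun block_coeff :: "(nat \<Rightarrow> nat) \<Rightarrow> nat \<Rightarrow> (nat set \<Rightarrow> 'f) endo" where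
  "block_coeff h 0 = eps (h 0) * eps (h 1)"
| "block_coeff h (Suc t) = block_coeff h t * (eta (h (2*t+1)) * eta (h (2*t+2)))
     * (eps (h (2*t+2)) * eps (h (2*t+3)))"

lemma even_op_eps2: "even_op (eps i * eps j)"
  by (intro even_op_vec2 vec_eps)

lemma even_op_eta2: "even_op (eta i * eta j)"
  by (intro even_op_vec2 vec_eta)

lemma even_op_block_coeff: "even_op (block_coeff h t)"
  by (induction t) (simp_all add: even_op_mult even_op_eps2 even_op_eta2)

lemma block_coeff_eps: "j < 2 * t + 2 \<Longrightarrow> block_coeff h t * eps (h j) = 0"
proof (induction t)
  case 0
  then have "j = 0 \<or> j = 1" by auto
  then show ?case using vec2_kills[OF vec_eps vec_eps, of 1] by auto
next
  case (Suc t)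
  consider "j < 2 * t + 2" | "j = 2 * t + 2" | "j = 2 * t + 3" using Suc.prems by atomize_elim auto
  then show ?case
  proof cases
    case 1
    then show ?thesis
      by (simp only: block_coeff.simps) (intro even_op_kills Suc.IH even_op_eps2 even_op_eta2 vec_eps)
  qed (simp_all only: block_coeff.simps vec2_kills vec_eps)
qed

text \<open>For \<open>j = 0\<close> the vector is 0, and otherwise it already occurs in the
  coefficient. The vector of \<open>h (2*t+1)\<close> is not covered; it survives in the next
  bracket.\<close>

lemma block_coeff_eta: "h 0 \<notin> M \<Longrightarrow> j \<le> 2 * t \<Longrightarrow> block_coeff h t * eta (h j) = 0"
proof (induction t)
  case (Suc t)
  consider "j \<le> 2 * t" | "j = 2 * t + 1" | "j = 2 * t + 2" using Suc.prems by atomize_elim auto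
  then show ?case
  proof cases
    case 1
    with Suc show ?thesis
      by (simp only: block_coeff.simps) (intro even_op_kills even_op_eps2 even_op_eta2 vec_eta, simp)
  qed (simp_all only: block_coeff.simps, auto intro!: even_op_kills even_op_eps2 vec_eta vec2_kills)
qed (simp add: eta_def)

lemma kills_weps: "(\<And>i. i \<in> set w \<Longrightarrow> x * eps i = 0) \<Longrightarrow> x * weps w = 0"
  by (induction w) (simp_all add: distrib_left)

lemma kills_weta: "(\<And>i. i \<in> set w \<Longrightarrow> x * eta i = 0) \<Longrightarrow> x * weta w = 0"
  by (induction w) (simp_all add: distrib_left)

lemma bracket_gen:
  assumes "even_op x"
  shows "bracket (lft x * word w) (gen a) = lft (x * (wtwist w [a] - 1)) * word (a # w)"
  using bracket_words[OF assms even_op_one, of w "[a]"] by (simp add: lft_hom)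

lemma bracket_gen_eps:
  assumes "even_op x" "x * weps w = 0"
  shows "bracket (lft x * word w) (gen a) = lft (x * weta w * eta a) * word (a # w)"
proof -
  have "x * (wtwist w [a] - 1) = x * weps w * eps a * (1 + weta w * eta a) + x * weta w * eta a"
    by (simp add: wtwist_minus_one distrib_left mult.assoc)
  then show ?thesis using assms by (simp add: bracket_gen)
qed

lemma bracket_gen_eta:
  assumes "even_op x" "x * weta w = 0"
  shows "bracket (lft x * word w) (gen a) = lft (x * weps w * eps a) * word (a # w)"
proof -
  have "wtwist w [a] - 1 = weps w * weps [a] + weta w * weta [a] * (weps w * weps [a] + 1)"
    unfolding wtwist_minus_one by (simp only: distrib_left weta2_weps2_commute mult_1_right add.assoc add.commute)
       (simp add: algebra_simps)
  then have "x * (wtwist w [a] - 1)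
      = x * weps w * eps a + x * weta w * eta a * (weps w * weps [a] + 1)"
    by (simp only: distrib_left mult.assoc) simp
  then show ?thesis using assms by (simp add: bracket_gen)
qed

text \<open>Each induction step adds two brackets. In the first, \<open>x\<close> kills all epsilon
  vectors of \<open>w\<close> and leaves only \<open>eta l\<close> of the eta vectors; in the
  second, \<open>y\<close> kills all eta vectors of \<open>a # w\<close> and leaves only
  \<open>eps a\<close>.\<close>

lemma bracket_block:
  assumes "h 0 \<notin> M"
  shows "bracket_rev (map gen (rev (map h [0..<2*t+2])))
    = lft (block_coeff h t) * word (rev (map h [0..<2*t+2]))"
proof (induction t)
  case 0
  have "bracket (lft 1 * word [h 0]) (gen (h 1)) = lft (1 * weps [h 0] * eps (h 1)) * word [h 1, h 0]"
    by (rule bracket_gen_eta) (simp_all add: even_op_one eta_def assms)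
  then show ?case by (simp add: lft_hom numeral_2_eq_2)
next
  case (Suc t)
  define w where "w = rev (map h [0..<2*t+2])"
  define l a b where "l = h (2*t+1)" and "a = h (2*t+2)" and "b = h (2*t+3)"
  define x where "x = block_coeff h t"
  define y where "y = x * (eta l * eta a)"
  have x: "even_op x" by (simp add: x_def even_op_block_coeff)
  have y: "even_op y" by (simp add: y_def x even_op_mult even_op_eta2)
  have w: "rev (map h [0..<2 * Suc t + 2]) = b # a # w"
    by (simp add: w_def a_def b_def numeral_2_eq_2 numeral_3_eq_3)
  have x_eps: "x * weps w = 0"
    by (rule kills_weps) (auto simp: w_def x_def intro!: block_coeff_eps)
  have "x * weta (rev (map h [0..<2*t+1])) = 0"
    by (rule kills_weta) (auto simp: x_def intro!: block_coeff_eta assms)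
  moreover have "w = l # rev (map h [0..<2*t+1])" by (simp add: w_def l_def)
  ultimately have x_eta: "x * weta w = x * eta l" by (simp add: distrib_left)
  have "bracket (lft x * word w) (gen a) = lft y * word (a # w)"
    unfolding bracket_gen_eps[OF x x_eps] x_eta y_def by (simp add: mult.assoc)
  moreover have "y * weta (a # w) = 0"
  proof -
    \<comment> \<open>The factor \<open>x\<close> reduces \<open>weta w\<close> to
      \<open>eta l\<close>, which already occurs in \<open>y\<close>.\<close>
    have "y * weta w = x * weta w * (eta l * eta a)"
      unfolding y_def mult.assoc using even_op_vec[OF even_op_eta2 vec_weta, of l a w] by (simp add: mult.assoc)
    also have "\<dots> = x * (eta l * eta l) * eta a" unfolding x_eta by (simp add: mult.assoc)
    finally have "y * weta w = 0" by (simp add: vec_square vec_eta)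
    then show ?thesis by (simp add: distrib_left y_def vec2_kills vec_eta)
  qed
  then have "bracket (lft y * word (a # w)) (gen b) = lft (y * weps (a # w) * eps b) * word (b # a # w)"
    by (rule bracket_gen_eta[OF y])
  moreover have "y * weps (a # w) = y * eps a"
    using even_op_kills[OF even_op_eta2 vec_weps x_eps, of l a] by (simp add: distrib_left y_def)
  moreover have "bracket_rev (map gen w) = lft x * word w"
    using Suc.IH by (simp only: w_def x_def)
  moreover have "w \<noteq> []" by (simp add: w_def)
  then have "bracket_rev (map gen (b # a # w)) = bracket (bracket (bracket_rev (map gen w)) (gen a)) (gen b)"
    by (simp add: bracket_rev_Cons)
  ultimately have "bracket_rev (map gen (b # a # w)) = lft (y * eps a * eps b) * word (b # a # w)"
    by (simp only:)
  then show ?case unfolding w by (simp add: y_def x_def l_def a_def b_def mult.assoc)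
qed

fun block_crs :: "(nat \<Rightarrow> nat) \<Rightarrow> nat \<Rightarrow> nat list" where
  "block_crs h 0 = [2 * h 0, 2 * h 1]"
| "block_crs h (Suc t) = block_crs h t @ [2 * h (2*t+1) + 1, 2 * h (2*t+2) + 1, 2 * h (2*t+2), 2 * h (2*t+3)]"

lemma block_coeff_crs:
  "(\<And>j. 1 \<le> j \<Longrightarrow> j \<le> 2 * t \<Longrightarrow> h j \<in> M) \<Longrightarrow> block_coeff h t = prod_list (map cr (block_crs h t))"
  by (induction t) (simp_all add: eps_def eta_def mult.assoc)

lemma set_block_crs:
  "set (block_crs h t) = (\<lambda>j. 2 * h j) ` {..<2*t+2} \<union> (\<lambda>j. 2 * h j + 1) ` {1..2*t}"
proof (induction t)
  case 0
  show ?case by (auto simp: lessThan_Suc)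
next
  case (Suc t)
  have "{..<2 * Suc t + 2} = {..<2*t+2} \<union> {2*t+2, 2*t+3}" "{1..2 * Suc t} = {1..2*t} \<union> {2*t+1, 2*t+2}"
    by auto
  then show ?case by (simp only: block_crs.simps set_append Suc.IH image_Un) auto
qed

lemma distinct_block_crs:
  assumes "inj h" shows "distinct (block_crs h t)"
proof (induction t)
  case 0
  then show ?case using assms by (auto dest: injD)
next
  case (Suc t)
  have [simp]: "h i = h j \<longleftrightarrow> i = j" for i j using assms by (auto dest: injD)
  show ?case by (simp only: block_crs.simps distinct_append Suc.IH set_block_crs)
      (auto simp: Suc_double_not_eq_double double_not_eq_Suc_double)
qed

end

section \<open>Noncommutative power series\<close>

text \<open>A word has finitely many splittings into two parts, so the product is defined for
  arbitrary coefficient functions and the carrier is the whole type.\<close>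

definition word_series :: "(nat list \<Rightarrow> 'f::field) ring" where
  "word_series = \<lparr>carrier = UNIV,
     mult = (\<lambda>f g w. \<Sum>i\<le>length w. f (take i w) * g (drop i w)),
     one = (\<lambda>w. if w = [] then 1 else 0), zero = (\<lambda>w. 0), add = (\<lambda>f g w. f w + g w)\<rparr>"

lemma word_series_simps [simp]:
  "carrier word_series = UNIV"
  "(f \<otimes>\<^bsub>word_series\<^esub> g) w = (\<Sum>i\<le>length w. f (take i w) * g (drop i w))"
  "\<one>\<^bsub>word_series\<^esub> w = (if w = [] then 1 else 0)"
  "\<zero>\<^bsub>word_series\<^esub> w = 0"
  "(f \<oplus>\<^bsub>word_series\<^esub> g) w = f w + g w"
  by (simp_all add: word_series_def)

lemma word_series_assoc:
  "(f \<otimes>\<^bsub>word_series\<^esub> g) \<otimes>\<^bsub>word_series\<^esub> h = f \<otimes>\<^bsub>word_series\<^esub> (g \<otimes>\<^bsub>word_series\<^esub> h)"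
proof
  fix w :: "nat list"
  let ?n = "length w"
  have "((f \<otimes>\<^bsub>word_series\<^esub> g) \<otimes>\<^bsub>word_series\<^esub> h) w
      = (\<Sum>i\<le>?n. \<Sum>j\<le>i. f (take j w) * g (drop j (take i w)) * h (drop i w))"
    by (auto simp: sum_distrib_right min_absorb1 min_absorb2 intro!: sum.cong)
  also have "\<dots> = (\<Sum>(i, j)\<in>Sigma {..?n} (\<lambda>i. {..i}). f (take j w) * g (drop j (take i w)) * h (drop i w))"
    by (simp add: sum.Sigma)
  \<comment> \<open>The two cut points \<open>j\<close> and \<open>i\<close> are replaced by the
    first one and the length \<open>k = i - j\<close> of the middle part.\<close>
  also have "\<dots> = (\<Sum>(j, k)\<in>Sigma {..?n} (\<lambda>j. {..?n - j}). f (take j w) * (g (take k (drop j w)) * h (drop k (drop j w))))"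
    by (rule sum.reindex_bij_witness[of _ "\<lambda>(j, k). (j + k, j)" "\<lambda>(i, j). (j, i - j)"])
      (auto simp: drop_take mult.assoc)
  also have "\<dots> = (f \<otimes>\<^bsub>word_series\<^esub> (g \<otimes>\<^bsub>word_series\<^esub> h)) w"
    by (simp add: sum.Sigma[symmetric] sum_distrib_left)
  finally show "((f \<otimes>\<^bsub>word_series\<^esub> g) \<otimes>\<^bsub>word_series\<^esub> h) w = \<dots>" .
qed

lemma word_series_one:
  "\<one>\<^bsub>word_series\<^esub> \<otimes>\<^bsub>word_series\<^esub> f = f" "f \<otimes>\<^bsub>word_series\<^esub> \<one>\<^bsub>word_series\<^esub> = f"
proof -
  have "(\<Sum>i\<le>length w. (if take i w = [] then 1 else 0) * f (drop i w)) = f w" for w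
    by (subst sum.mono_neutral_right[of _ "{0}"]) auto
  then show "\<one>\<^bsub>word_series\<^esub> \<otimes>\<^bsub>word_series\<^esub> f = f" by (simp add: fun_eq_iff)
  have "(\<Sum>i\<le>length w. f (take i w) * (if drop i w = [] then 1 else 0)) = f w" for w
    by (subst sum.mono_neutral_right[of _ "{length w}"]) auto
  then show "f \<otimes>\<^bsub>word_series\<^esub> \<one>\<^bsub>word_series\<^esub> = f" by (simp add: fun_eq_iff)
qed

lemma ring_word_series: "ring (word_series :: (nat list \<Rightarrow> 'f::field) ring)" (is "ring ?R")
proof (rule ringI)
  show "abelian_group ?R"
  proof (rule abelian_groupI)
    show "\<exists>y\<in>carrier ?R. y \<oplus>\<^bsub>?R\<^esub> f = \<zero>\<^bsub>?R\<^esub>" for f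
      by (rule bexI[of _ "\<lambda>w. - f w"]) (simp_all add: fun_eq_iff)
  qed (simp_all add: fun_eq_iff algebra_simps)
  show "monoid ?R"
    by (rule monoidI) (simp_all add: word_series_assoc word_series_one)
qed (simp_all add: fun_eq_iff algebra_simps sum.distrib)

lemma unital_algebra_word_series: "unital_algebra word_series (\<lambda>c f w. c * f w)"
  unfolding unital_algebra_def
  by (simp add: ring_word_series fun_eq_iff algebra_simps sum_distrib_left)

context twisted_letters
begin

section \<open>Evaluation of series at the generators\<close>

definition good_words :: "nat list set" where
  "good_words = {w. set w \<subseteq> L \<and> distinct w}"

text \<open>All other words evaluate to 0, so this finite sum is the substitution of the generators
  into an arbitrary series.\<close>

definition series_eval :: "(nat list \<Rightarrow> 'f) \<Rightarrow> (nat set \<Rightarrow> nat set \<Rightarrow> 'f) endo" where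
  "series_eval f = (\<Sum>w\<in>good_words. lft (sc (f w)) * word w)"

lemma finite_good_words: "finite good_words"
  unfolding good_words_def by (rule finite_subset_distinct[OF finite_L])

lemma word_eq_0_good: "w \<notin> good_words \<Longrightarrow> word w = 0"
  by (rule word_eq_0) (auto simp: good_words_def)

lemma series_eval_add: "series_eval (f \<oplus>\<^bsub>word_series\<^esub> g) = series_eval f + series_eval g"
  by (simp add: series_eval_def sc_hom lft_hom distrib_right sum.distrib)

lemma series_eval_zero: "series_eval \<zero>\<^bsub>word_series\<^esub> = 0"
  by (simp add: series_eval_def sc_hom lft_hom)

lemma series_eval_one: "series_eval \<one>\<^bsub>word_series\<^esub> = 1"
proof -
  have "series_eval \<one>\<^bsub>word_series\<^esub> = (\<Sum>w\<in>{[]}. lft (sc (\<one>\<^bsub>word_series\<^esub> w)) * word w)"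
    unfolding series_eval_def
    by (rule sum.mono_neutral_right[OF finite_good_words]) (auto simp: good_words_def sc_hom lft_hom)
  then show ?thesis by (simp add: sc_hom lft_hom)
qed

lemma sc_sum: "sc (sum g S) = (\<Sum>s\<in>S. sc (g s))"
  by (induction S rule: infinite_finite_induct) (simp_all add: sc_hom)

lemma lft_sum: "lft (sum g S) = (\<Sum>s\<in>S. lft (g s))"
  by (induction S rule: infinite_finite_induct) (simp_all add: lft_hom)

lemma series_eval_mult: "series_eval (f \<otimes>\<^bsub>word_series\<^esub> g) = series_eval f * series_eval g"
proof -
  let ?t = "\<lambda>u v. lft (sc (f u * g v)) * word (u @ v)"
  have "series_eval f * series_eval g = (\<Sum>u\<in>good_words. \<Sum>v\<in>good_words. ?t u v)"
    unfolding series_eval_def sum_product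
  proof (intro sum.cong refl)
    fix u v
    have "lft (sc (f u)) * word u * (lft (sc (g v)) * word v) = lft (sc (f u)) * lft (sc (g v)) * (word u * word v)"
      by (rule mult_interchange) (rule word_lft[OF even_op_sc])
    then show "lft (sc (f u)) * word u * (lft (sc (g v)) * word v) = ?t u v"
      by (simp add: sc_hom lft_hom)
  qed
  also have "\<dots> = (\<Sum>(u, v)\<in>good_words \<times> good_words. ?t u v)"
    by (simp add: sum.cartesian_product)
  \<comment> \<open>The discarded pairs have a concatenation that evaluates to 0; the others amount
    to a good word with a cut position, as in the product of series.\<close>
  also have "\<dots> = (\<Sum>(u, v)\<in>{(u, v). u @ v \<in> good_words}. ?t u v)"
  proof (rule sum.mono_neutral_right)
    show "{(u, v). u @ v \<in> good_words} \<subseteq> good_words \<times> good_words"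
      by (auto simp: good_words_def)
    have "?t u v = 0" if "u @ v \<notin> good_words" for u v
      unfolding word_eq_0_good[OF that] by simp
    then show "\<forall>x\<in>good_words \<times> good_words - {(u, v). u @ v \<in> good_words}. (case x of (u, v) \<Rightarrow> ?t u v) = 0"
      unfolding case_prod_beta by blast
  qed (simp add: finite_good_words)
  also have "\<dots> = (\<Sum>(w, i)\<in>Sigma good_words (\<lambda>w. {..length w}). ?t (take i w) (drop i w))"
    by (rule sum.reindex_bij_witness[of _ "\<lambda>(w, i). (take i w, drop i w)" "\<lambda>(u, v). (u @ v, length u)"])
      auto
  also have "\<dots> = (\<Sum>w\<in>good_words. \<Sum>i\<le>length w. ?t (take i w) (drop i w))"
    by (subst sum.Sigma) (auto simp: finite_good_words)
  also have "\<dots> = series_eval (f \<otimes>\<^bsub>word_series\<^esub> g)"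
    unfolding series_eval_def by (simp add: sc_sum lft_sum sum_distrib_right del: word_simps(3))
  finally show ?thesis by simp
qed

lemma series_eval_minus: "series_eval (f \<ominus>\<^bsub>word_series\<^esub> g) = series_eval f - series_eval g"
proof -
  interpret ring "word_series :: (nat list \<Rightarrow> 'f) ring" by (rule ring_word_series)
  have "(f \<ominus>\<^bsub>word_series\<^esub> g) \<oplus>\<^bsub>word_series\<^esub> g = f"
    by (simp add: a_minus_def a_assoc l_neg)
  then show ?thesis using series_eval_add[of "f \<ominus>\<^bsub>word_series\<^esub> g" g] by simp
qed

lemma series_eval_lcomm_rev: "series_eval (lcomm_rev word_series fs) = bracket_rev (map series_eval fs)"
proof (induction fs rule: induct_list012)
  case (3 f g fs)
  then show ?case by (simp add: commutator_def bracket_def series_eval_minus series_eval_mult)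
qed (simp_all only: lcomm_rev.simps bracket_rev.simps list.map series_eval_zero)

lemma series_eval_mono_terms: "series_eval f \<in> add_span mono_terms"
  unfolding series_eval_def by (intro add_span_sum add_span_base) (auto simp: mono_terms_def)

lemma series_eval_letter:
  assumes "i \<in> L"
  shows "series_eval (\<lambda>w. if w = [i] then 1 else 0) = gen i"
proof -
  have "series_eval (\<lambda>w. if w = [i] then 1 else 0) = (\<Sum>w\<in>{[i]}. lft (sc (if w = [i] then 1 else 0)) * word w)"
    unfolding series_eval_def
    by (rule sum.mono_neutral_right[OF finite_good_words]) (auto simp: good_words_def sc_hom lft_hom assms)
  then show ?thesis by (simp add: sc_hom lft_hom)
qed

lemma ideal_kernel: "ideal {f. series_eval f = 0} word_series"
proof -
  interpret ring "word_series :: (nat list \<Rightarrow> 'f) ring" by (rule ring_word_series)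
  have neg: "series_eval (\<ominus>\<^bsub>word_series\<^esub> f) = - series_eval f" for f
    using series_eval_minus[of "\<zero>\<^bsub>word_series\<^esub>" f] by (simp add: minus_eq series_eval_zero)
  have "subgroup {f. series_eval f = 0} (add_monoid word_series)"
  proof (rule subgroup.intro)
    show "inv\<^bsub>add_monoid word_series\<^esub> f \<in> {f. series_eval f = 0}" if "f \<in> {f. series_eval f = 0}" for f
      using that neg[of f] by (simp only: mem_Collect_eq a_inv_def neg_equal_0_iff_equal)
  qed (auto simp: series_eval_add series_eval_zero)
  then show ?thesis
    by (rule idealI[OF ring_word_series]) (simp_all add: series_eval_mult)
qed

lemma T_ideal_kernel:
  assumes "card M = 2 * n" "f \<in> T_ideal word_series (2 * n + 3)"
  shows "series_eval f = 0"
proof -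
  interpret ring "word_series :: (nat list \<Rightarrow> 'f) ring" by (rule ring_word_series)
  have "series_eval (lcomm word_series fs) = 0" if "length fs = 2 * n + 3" for fs
    unfolding lcomm_def series_eval_lcomm_rev
    by (rule bracket_rev_eq_0[OF assms(1)]) (use that in \<open>auto intro: series_eval_mono_terms\<close>)
  then have "genideal word_series {lcomm word_series fs | fs. length fs = 2 * n + 3 \<and> set fs \<subseteq> carrier word_series}
      \<subseteq> {f. series_eval f = 0}"
    by (intro genideal_minimal ideal_kernel) auto
  then show ?thesis using assms(2) by (auto simp: T_ideal_def)
qed

end

section \<open>Commutator ideals\<close>

text \<open>Bracketing keeps an element inside the ideal, so commutators of even length may replace
  those of length exactly \<open>n\<close>.\<close>

lemma (in ring) lcomm_rev_in_T_ideal: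
  assumes "carrier R = UNIV" "length as \<ge> n" "n \<ge> 2"
  shows "lcomm_rev R as \<in> T_ideal R n"
  using assms(2)
proof (induction as)
  case (Cons a as)
  have id: "ideal (T_ideal R n) R"
    using assms(3) by (auto simp: T_ideal_def assms(1) intro!: genideal_ideal)
  show ?case
  proof (cases "length as \<ge> n")
    case True
    then have as: "lcomm_rev R as \<in> T_ideal R n" by (rule Cons.IH)
    have "lcomm_rev R (a # as) = lcomm_rev R as \<otimes> a \<ominus> a \<otimes> lcomm_rev R as"
      using True assms(3) by (cases as) (auto simp: commutator_def)
    then show ?thesis
      using ideal.I_r_closed[OF id as] ideal.I_l_closed[OF id as] assms(1)
        additive_subgroup.a_closed[OF ideal.axioms(1)[OF id]]
        additive_subgroup.a_inv_closed[OF ideal.axioms(1)[OF id]]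
      by (simp add: a_minus_def)
  next
    case False
    then have "length (rev (a # as)) = n" using Cons.prems by simp
    then have "lcomm R (rev (a # as)) \<in> T_ideal R n"
      using assms(3) unfolding T_ideal_def by (auto simp: assms(1) intro!: genideal_self[THEN subsetD])
    then show ?thesis by (simp add: lcomm_def)
  qed
qed (use assms(3) in simp)

lemma (in ring) prod_in_ideal_list_prod:
  assumes "carrier R = UNIV" "list_all2 (\<in>) zs Is"
  shows "foldr (\<otimes>) zs \<one> \<in> ideal_list_prod R Is"
  using assms(2)
proof (induction zs Is rule: list_all2_induct)
  case (Cons z zs I Is)
  show ?case
  proof (cases Is)
    case Nil
    then show ?thesis using Cons assms(1) by simp
  next
    case (Cons J Js)
    have "z \<otimes> foldr (\<otimes>) zs \<one> \<in> ideal_mult R I (ideal_list_prod R Is)"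
      unfolding ideal_mult_def using Cons.hyps Cons.IH assms(1)
      by (intro genideal_self[THEN subsetD]) auto
    then show ?thesis using \<open>Is = J # Js\<close> by simp
  qed
qed (simp add: assms(1))

lemma distinct_concat_map:
  assumes "distinct bs" "\<And>b. b \<in> set bs \<Longrightarrow> distinct (c b)"
    and "\<And>b b'. b \<noteq> b' \<Longrightarrow> set (c b) \<inter> set (c b') = {}"
  shows "distinct (concat (map c bs))"
  using assms(1,2)
proof (induction bs)
  case (Cons b bs)
  then have "set (c b) \<inter> set (c b') = {}" if "b' \<in> set bs" for b'
    using that assms(3)[of b b'] by auto
  then show ?case using Cons by auto
qed simp

lemma prod_list_concat_map:
  "prod_list (map (\<lambda>b. prod_list (map f (c b))) bs) = prod_list (map f (concat (map c bs)))"
  by (induction bs) simp_all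

context twisted_letters
begin

lemma prod_list_lft_word:
  assumes "\<And>b. even_op (x b)"
  shows "prod_list (map (\<lambda>b. lft (x b) * word (w b)) bs)
    = lft (prod_list (map x bs)) * word (concat (map w bs))"
proof -
  have even: "even_op (prod_list (map x bs))" for bs
    by (induction bs) (simp_all add: even_op_one even_op_mult assms)
  show ?thesis
  proof (induction bs)
    case (Cons b bs)
    have "lft (x b) * word (w b) * (lft (prod_list (map x bs)) * word (concat (map w bs)))
      = lft (x b) * lft (prod_list (map x bs)) * (word (w b) * word (concat (map w bs)))"
      by (rule mult_interchange) (rule word_lft[OF even])
    then show ?case using Cons by (simp add: lft_hom)
  qed (simp add: lft_hom)
qed

lemma series_eval_foldr:
  "series_eval (foldr (\<otimes>\<^bsub>word_series\<^esub>) zs \<one>\<^bsub>word_series\<^esub>) = prod_list (map series_eval zs)"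
proof (induction zs)
  case Nil
  then show ?case by (simp only: foldr_Nil id_apply series_eval_one list.map prod_list.Nil)
next
  case (Cons z zs)
  then show ?case by (simp only: foldr_Cons comp_apply series_eval_mult list.map prod_list.Cons)
qed

end

text \<open>Termwise, \<open>m i - 2\<close>, increased by 1 for odd \<open>m i\<close>, equals
  \<open>2 * ((m i - 1) div 2)\<close>.\<close>

lemma sum_minus_parity:
  fixes m :: "nat \<Rightarrow> nat"
  assumes "\<forall>i\<in>{1..k}. m i > 0" "card {i \<in> {1..k}. odd (m i)} = l"
  shows "(\<Sum>i=1..k. int (m i)) - 2 * int k + int l = 2 * int (\<Sum>i=1..k. (m i - 1) div 2)"
proof -
  have "int l = (\<Sum>i=1..k. if odd (m i) then 1 else 0)"
    unfolding assms(2)[symmetric] by (simp add: sum.If_cases Int_def)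
  then have "(\<Sum>i=1..k. int (m i)) - 2 * int k + int l
      = (\<Sum>i=1..k. int (m i) - 2 + (if odd (m i) then 1 else 0))"
    by (simp only: sum.distrib sum_subtractf) simp
  also have "\<dots> = (\<Sum>i=1..k. 2 * int ((m i - 1) div 2))"
  proof (rule sum.cong)
    fix i assume "i \<in> {1..k}"
    then have "m i > 0" using assms(1) by blast
    then show "int (m i) - 2 + (if odd (m i) then 1 else 0) = 2 * int ((m i - 1) div 2)"
      by (cases "odd (m i)") (auto elim!: oddE evenE, presburger+)
  qed simp
  finally show ?thesis by (simp add: sum_distrib_left)
qed

theorem theorem1p7:
  fixes k l :: nat and m :: "nat \<Rightarrow> nat"
  assumes "k > 0" and "l \<le> k"
    and "\<forall>i\<in>{1..k}. m i > 0"
    and "card {i \<in> {1..k}. odd (m i)} = l"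
    and "card {i \<in> {1..k}. even (m i)} = k - l"
  shows "\<exists>(A :: (nat list \<Rightarrow> 'f::field) ring) (smul :: 'f \<Rightarrow> (nat list \<Rightarrow> 'f) \<Rightarrow> (nat list \<Rightarrow> 'f)).
           unital_algebra A smul \<and>
           \<not> (ideal_list_prod A (map (\<lambda>i. T_ideal A (m i)) [1..<k+1])
                \<subseteq> T_ideal A (nat (1 + ((\<Sum>i=1..k. int (m i)) - 2 * int k + int l + 2))))"
proof -
  let ?A = "word_series :: (nat list \<Rightarrow> 'f) ring"
  define p where "p i = (m i - 1) div 2" for i
  define n where "n = (\<Sum>i=1..k. p i)"
  \<comment> \<open>This is letter \<open>j\<close> of block \<open>b\<close>; the pairing keeps the
    letters of different blocks apart.\<close>
  define h where "h b j = prod_encode (b, j)" for b j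
  \<comment> \<open>The first and last letters of a block get eta vector 0, because the coefficient
    of the commutator involves only the \<open>2 * p b\<close> inner ones.\<close>
  define M where "M = (\<Union>b\<in>{1..k}. h b ` {1..2 * p b})"
  define L where "L = (\<Union>b\<in>{1..k}. h b ` {..<2 * p b + 2})"
  have h_eq: "h b j = h b' j' \<longleftrightarrow> b = b' \<and> j = j'" for b j b' j'
    by (simp add: h_def)
  have h_M: "h b j \<in> M" if "b \<in> {1..k}" "1 \<le> j" "j \<le> 2 * p b" for b j
    unfolding M_def using that by (intro UN_I[of b] imageI) auto
  have inj_h: "inj (h b)" for b by (simp add: inj_def h_eq)
  interpret twisted_letters M L "TYPE('f)"
    by unfold_locales (simp_all add: M_def L_def)
  interpret A: ring ?A by (rule ring_word_series)
  have "card M = (\<Sum>b=1..k. card (h b ` {1..2 * p b}))"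
    unfolding M_def by (rule card_UN_disjoint) (auto simp: h_eq)
  also have "\<dots> = 2 * n"
    by (simp add: card_image inj_on_subset[OF inj_h] n_def sum_distrib_left)
  finally have card_M: "card M = 2 * n" .
  have exponent: "nat (1 + ((\<Sum>i=1..k. int (m i)) - 2 * int k + int l + 2)) = 2 * n + 3"
    using sum_minus_parity[OF assms(3,4)] unfolding n_def p_def by linarith

  define letter where "letter i = (\<lambda>w. if w = [i] then 1 else 0 :: 'f)" for i :: nat
  define z where "z b = lcomm ?A (map (letter \<circ> h b) [0..<2 * p b + 2])" for b
  define w where "w b = rev (map (h b) [0..<2 * p b + 2])" for b
  \<comment> \<open>For \<open>m b <= 1\<close> the ideal is everything; otherwise the length
    \<open>2 * p b + 2\<close> is at least \<open>m b\<close>.\<close>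
  have z_T: "z b \<in> T_ideal ?A (m b)" if "b \<in> {1..k}" for b
  proof (cases "m b \<le> 1")
    case False
    then show ?thesis unfolding z_def lcomm_def
      by (intro A.lcomm_rev_in_T_ideal) (auto simp: p_def)
  qed (simp add: T_ideal_def)
  have eval_z: "series_eval (z b) = lft (block_coeff (h b) (p b)) * word (w b)" if "b \<in> {1..k}" for b
  proof -
    have "h b 0 \<notin> M" by (auto simp: M_def h_eq)
    moreover have "series_eval (letter (h b j)) = gen (h b j)" if "j < 2 * p b + 2" for j
      unfolding letter_def using that \<open>b \<in> {1..k}\<close>
      by (intro series_eval_letter) (auto simp only: L_def intro!: imageI)
    then have "map series_eval (rev (map (letter \<circ> h b) [0..<2 * p b + 2])) = map gen (w b)"
      unfolding w_def rev_map map_map by (intro map_cong) auto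
    ultimately show ?thesis
      unfolding z_def lcomm_def series_eval_lcomm_rev by (simp only: bracket_block w_def not_False_eq_True)
  qed
  define bs where "bs = [1..<k+1]"
  have set_bs: "set bs = {1..k}" "distinct bs" by (auto simp: bs_def)
  let ?z = "foldr (\<otimes>\<^bsub>?A\<^esub>) (map z bs) \<one>\<^bsub>?A\<^esub>"
  let ?c = "\<lambda>b. block_crs (h b) (p b)"
  have "?z \<in> ideal_list_prod ?A (map (\<lambda>i. T_ideal ?A (m i)) bs)"
    by (rule A.prod_in_ideal_list_prod)
      (auto simp: list_all2_map1 list_all2_map2 set_bs z_T intro!: list.rel_refl_strong)
  moreover have "?z \<notin> T_ideal ?A (2 * n + 3)"
  proof
    assume "?z \<in> T_ideal ?A (2 * n + 3)"
    then have "series_eval ?z = 0" by (rule T_ideal_kernel[OF card_M])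
    moreover have "series_eval ?z = prod_list (map (\<lambda>b. lft (block_coeff (h b) (p b)) * word (w b)) bs)"
      unfolding series_eval_foldr map_map
      by (rule arg_cong[where f = prod_list]) (simp add: eval_z set_bs)
    also have "\<dots> = lft (prod_list (map (\<lambda>b. block_coeff (h b) (p b)) bs)) * word (concat (map w bs))"
      by (rule prod_list_lft_word) (rule even_op_block_coeff)
    also have "map (\<lambda>b. block_coeff (h b) (p b)) bs = map (\<lambda>b. prod_list (map cr (?c b))) bs"
      by (intro map_cong refl block_coeff_crs h_M) (auto simp: set_bs)
    also note prod_list_concat_map
    \<comment> \<open>Different blocks use disjoint letters, hence disjoint basis vectors, so
      nothing repeats in the total product.\<close>
    also have "lft (prod_list (map cr (concat (map ?c bs)))) * word (concat (map w bs)) \<noteq> 0"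
    proof (rule prod_cr_word_nonzero)
      show "distinct (concat (map ?c bs))"
      proof (rule distinct_concat_map)
        show "set (?c b) \<inter> set (?c b') = {}" if "b \<noteq> b'" for b b'
          using that unfolding set_block_crs
          by (auto simp: h_eq Suc_double_not_eq_double double_not_eq_Suc_double)
      qed (simp_all add: set_bs distinct_block_crs inj_h)
      show "distinct (concat (map w bs))"
        by (rule distinct_concat_map)
          (auto simp: set_bs w_def h_eq distinct_map inj_on_subset[OF inj_h])
      show "set (concat (map w bs)) \<subseteq> L"
        by (auto simp: set_bs w_def L_def)
    qed
    ultimately show False by simp
  qed
  ultimately show ?thesis
    using unital_algebra_word_series unfolding exponent bs_def by blast
qed

end
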